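(* Let $\mathfrak S$ be a (cofinite) translative $G$-semimatroid and let $e\in E_{\mathfrak S}$. Then: (1) if $e$ is neither a loop nor an isthmus of $\mathcal S_{\mathfrak S}$, then $T_{\mathfrak S}(x,y)=T_{\mathfrak S/e}(x,y)+T_{\mathfrak S\setminus e}(x,y)$; (2) if $e$ is an isthmus of $\mathcal S_{\mathfrak S}$, then $T_{\mathfrak S}(x,y)=(x-1)T_{\mathfrak S\setminus e}(x,y)+T_{\mathfrak S/e}(x,y)$; (3) if $e$ is a loop of $\mathcal S_{\mathfrak S}$, then $T_{\mathfrak S}(x,y)=T_{\mathfrak S\setminus e}(x,y)+(y-1)T_{\mathfrak S/e}(x,y)$.
   Context: A finitary semimatroid is a triple $\mathcal S=(S,\mathcal C,\mathrm{rk})$ where $S$ is a (possibly infinite) set, $\mathcal C$ is a non-empty finite-dimensional simplicial complex on $S$ (a family of finite subsets of bounded cardinality, closed under taking subsets) with $\{x\}\in\mathcal C$ for all $x\in S$, and $\mathrm{rk}:\mathcal C\to\mathbb N$ is a bounded function such that: (R1) $0\le \mathrm{rk}(X)\le |X|$; (R2) $X\subseteq Y$ in $\mathcal C$ implies $\mathrm{rk}(X)\le\mathrm{rk}(Y)$; (R3) if $X,Y,X\cup Y\in\mathcal C$ then $\mathrm{rk}(X)+\mathrm{rk}(Y)\ge \mathrm{rk}(X\cup Y)+\mathrm{rk}(X\cap Y)$; (CR1) if $X,Y\in\mathcal C$ and $\mathrm{rk}(X)=\mathrm{rk}(X\cap Y)$ then $X\cup Y\in\mathcal C$; (CR2) if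 $X,Y\in\mathcal C$ and $\mathrm{rk}(X)<\mathrm{rk}(Y)$ then $X\cup\{y\}\in\mathcal C$ for some $y\in Y\setminus X$. A triple only known to satisfy (R1)–(R3) is a locally ranked triple. In a locally ranked triple $(E,\mathcal D,r)$ a loop is $s\in E$ with $r(\{s\})=0$; an isthmus is $s\in E$ such that for every $X\in\mathcal D$ with $s\notin X$ one has $X\cup\{s\}\in\mathcal D$ and $r(X\cup\{s\})=r(X)+1$. For $T\subseteq S$ the deletion is $\mathcal S\setminus T:=(S\setminus T,\ \mathcal C\cap 2^{S\setminus T},\ \mathrm{rk})$. For $X\in\mathcal C$ the contraction is $\mathcal S/X:=(S_{/X},\mathcal C_{/X},\mathrm{rk}_{/X})$ with $\mathcal C_{/X}:=\{Y\in\mathcal C: Y\cap X=\emptyset,\ Y\cup X\in\mathcal C\}$, $S_{/X}:=\{s:\{s\}\in\mathcal C_{/X}\}$, $\mathrm{rk}_{/X}(Y):=\mathrm{rk}(Y\cup X)-\mathrm{rk}(X)$. Both are finitary semimatroids. A $G$-semimatroid $\mathfrak S$ is a finitary semimatroid $\mathcal S$ with an action of a group $G$ on $S$ whose induced action on $2^S$ preserves centrality (membership in $\mathcal C$) and rank. For $X\subseteq S$ let $\underline X:=\{Gx: x\in X\}$. Put $E_{\mathfrak S}:=S/G$, $\mathcal C_{\mathfrak S}:=\mathcal C/G$, $\underline{\mathcal C}:=\{\underline X: X\in\mathcal C\}$, and for $A\subseteq E_{\mathfrak S}$: $\underline{\mathrm{rk}}(A):=\max\{\mathrm{rk}(X):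 X\in\mathcal C,\ \underline X\subseteq A\}$, $m_{\mathfrak S}(A):=|\{X\in\mathcal C:\underline X=A\}/G|$. Cofinite means $\mathcal C_{\mathfrak S}$ finite; translative means: $\{x,g(x)\}\in\mathcal C$ implies $g(x)=x$ ($g\in G,x\in S$). Then $\mathcal S_{\mathfrak S}:=(E_{\mathfrak S},\underline{\mathcal C},\underline{\mathrm{rk}})$ is a finite locally ranked triple. Define $T_{\mathfrak S}(x,y):=\sum_{A\in\underline{\mathcal C}}m_{\mathfrak S}(A)(x-1)^{\underline{\mathrm{rk}}(E_{\mathfrak S})-\underline{\mathrm{rk}}(A)}(y-1)^{|A|-\underline{\mathrm{rk}}(A)}$. For $e\in E_{\mathfrak S}$ (an orbit, i.e. a subset of $S$): $\mathfrak S\setminus e$ is the $G$-semimatroid given by the action of $G$ on $\mathcal S\setminus e$ (all elements of the orbit $e$ are deleted); $\mathfrak S/e$ is the $\mathrm{stab}(x_e)$-semimatroid given by the action of $\mathrm{stab}(x_e)$ on $\mathcal S/\{x_e\}$, for any chosen representative $x_e\in e$ (the choice is immaterial up to isomorphism). *)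

theory Defs
  imports "HOL-Algebra.Group_Action"
begin

section \<open>Ranked triples and finitary semimatroids\<close>

text \<open>Only the values of \<open>rk\<close> on \<open>central\<close> sets matter, except for the rank function of
  the orbit triple below, which is meaningful on every set of orbits.\<close>

record 'a ranked_triple =
  ground :: "'a set"
  central :: "'a set set"
  rk :: "'a set \<Rightarrow> nat"

locale locally_ranked_triple =
  fixes \<S> :: "'a ranked_triple"
  assumes central_nonempty: "central \<S> \<noteq> {}"
    and central_subset_ground: "X \<in> central \<S> \<Longrightarrow> X \<subseteq> ground \<S>"
    and central_finite: "X \<in> central \<S> \<Longrightarrow> finite X"
    and central_card_bounded: "\<exists>n. \<forall>X \<in> central \<S>. card X \<le> n"
    and central_down: "X \<in> central \<S> \<Longrightarrow> Y \<subseteq> X \<Longrightarrow> Y \<in> central \<S>"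
    and central_singleton: "s \<in> ground \<S> \<Longrightarrow> {s} \<in> central \<S>"
    and rk_bounded: "\<exists>n. \<forall>X \<in> central \<S>. rk \<S> X \<le> n"
    and R1: "X \<in> central \<S> \<Longrightarrow> rk \<S> X \<le> card X"
    and R2: "X \<in> central \<S> \<Longrightarrow> Y \<in> central \<S> \<Longrightarrow> X \<subseteq> Y \<Longrightarrow> rk \<S> X \<le> rk \<S> Y"
    and R3: "X \<in> central \<S> \<Longrightarrow> Y \<in> central \<S> \<Longrightarrow> X \<union> Y \<in> central \<S>
      \<Longrightarrow> rk \<S> X + rk \<S> Y \<ge> rk \<S> (X \<union> Y) + rk \<S> (X \<inter> Y)"

locale finitary_semimatroid = locally_ranked_triple +
  assumes CR1: "X \<in> central \<S> \<Longrightarrow> Y \<in> central \<S> \<Longrightarrow> rk \<S> X = rk \<S> (X \<inter> Y)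
      \<Longrightarrow> X \<union> Y \<in> central \<S>"
    and CR2: "X \<in> central \<S> \<Longrightarrow> Y \<in> central \<S> \<Longrightarrow> rk \<S> X < rk \<S> Y
      \<Longrightarrow> \<exists>y \<in> Y - X. X \<union> {y} \<in> central \<S>"

definition is_loop :: "'a ranked_triple \<Rightarrow> 'a \<Rightarrow> bool" where
  "is_loop \<S> s \<longleftrightarrow> s \<in> ground \<S> \<and> rk \<S> {s} = 0"

definition is_isthmus :: "'a ranked_triple \<Rightarrow> 'a \<Rightarrow> bool" where
  "is_isthmus \<S> s \<longleftrightarrow> s \<in> ground \<S> \<and>
    (\<forall>X \<in> central \<S>. s \<notin> X \<longrightarrow> X \<union> {s} \<in> central \<S> \<and> rk \<S> (X \<union> {s}) = rk \<S> X + 1)"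

definition deletion :: "'a ranked_triple \<Rightarrow> 'a set \<Rightarrow> 'a ranked_triple" where
  "deletion \<S> T =
    \<lparr>ground = ground \<S> - T, central = central \<S> \<inter> Pow (ground \<S> - T), rk = rk \<S>\<rparr>"

definition contraction :: "'a ranked_triple \<Rightarrow> 'a set \<Rightarrow> 'a ranked_triple" where
  "contraction \<S> X =
    (let C = {Y \<in> central \<S>. Y \<inter> X = {} \<and> Y \<union> X \<in> central \<S>}
     in \<lparr>ground = {s. {s} \<in> C}, central = C, rk = (\<lambda>Y. rk \<S> (Y \<union> X) - rk \<S> X)\<rparr>)"


section \<open>Group actions on semimatroids\<close>

record ('g, 'a) semimatroid_action =
  grp :: "'g monoid"
  act :: "'g \<Rightarrow> 'a \<Rightarrow> 'a"
  smat :: "'a ranked_triple"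

locale G_semimatroid =
  finitary_semimatroid "smat \<SS>" + group_action "grp \<SS>" "ground (smat \<SS>)" "act \<SS>"
  for \<SS> :: "('g, 'a) semimatroid_action" +
  assumes act_central: "g \<in> carrier (grp \<SS>) \<Longrightarrow> X \<in> central (smat \<SS>)
      \<Longrightarrow> act \<SS> g ` X \<in> central (smat \<SS>)"
    and act_rk: "g \<in> carrier (grp \<SS>) \<Longrightarrow> X \<in> central (smat \<SS>)
      \<Longrightarrow> rk (smat \<SS>) (act \<SS> g ` X) = rk (smat \<SS>) X"

text \<open>The quotient of a family of subsets by the induced action on the power set.\<close>

definition set_orbits :: "('g, 'a) semimatroid_action \<Rightarrow> 'a set set \<Rightarrow> 'a set set set" where
  "set_orbits \<SS> F = orbits (grp \<SS>) F (\<lambda>g X. act \<SS> g ` X)"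

definition cofinite_action :: "('g, 'a) semimatroid_action \<Rightarrow> bool" where
  "cofinite_action \<SS> \<longleftrightarrow> finite (set_orbits \<SS> (central (smat \<SS>)))"

definition translative :: "('g, 'a) semimatroid_action \<Rightarrow> bool" where
  "translative \<SS> \<longleftrightarrow> (\<forall>g \<in> carrier (grp \<SS>). \<forall>x \<in> ground (smat \<SS>).
    {x, act \<SS> g x} \<in> central (smat \<SS>) \<longrightarrow> act \<SS> g x = x)"

definition underl :: "('g, 'a) semimatroid_action \<Rightarrow> 'a set \<Rightarrow> 'a set set" where
  "underl \<SS> X = orbit (grp \<SS>) (act \<SS>) ` X"

definition orbit_triple :: "('g, 'a) semimatroid_action \<Rightarrow> 'a set ranked_triple" where
  "orbit_triple \<SS> =
    \<lparr>ground = orbits (grp \<SS>) (ground (smat \<SS>)) (act \<SS>),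
     central = underl \<SS> ` central (smat \<SS>),
     rk = (\<lambda>A. Max {rk (smat \<SS>) X | X. X \<in> central (smat \<SS>) \<and> underl \<SS> X \<subseteq> A})\<rparr>"

definition multiplicity :: "('g, 'a) semimatroid_action \<Rightarrow> 'a set set \<Rightarrow> nat" where
  "multiplicity \<SS> A = card (set_orbits \<SS> {X \<in> central (smat \<SS>). underl \<SS> X = A})"

text \<open>Both exponents are differences of natural numbers that are non-negative for
  translative actions, so truncated subtraction does no harm. The polynomial is
  represented by its values at all pairs of elements of all nonzero commutative rings; the
  polynomial in \<open>\<int>[x,y]\<close> itself is the value at the two indeterminates.\<close>

definition tutte_poly :: "('g, 'a) semimatroid_action \<Rightarrow> 'r::comm_ring_1 \<Rightarrow> 'r \<Rightarrow> 'r" where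
  "tutte_poly \<SS> x y =
    (let Q = orbit_triple \<SS> in
     \<Sum>A \<in> central Q. of_nat (multiplicity \<SS> A)
       * (x - 1) ^ (rk Q (ground Q) - rk Q A) * (y - 1) ^ (card A - rk Q A))"

text \<open>Actions in the sense of \<^locale>\<open>group_action\<close> are extensional, so the action has to be
  restricted to the new ground set.\<close>

definition action_deletion ::
  "('g, 'a) semimatroid_action \<Rightarrow> 'a set \<Rightarrow> ('g, 'a) semimatroid_action" where
  "action_deletion \<SS> e =
    (let \<S>' = deletion (smat \<SS>) e
     in \<lparr>grp = grp \<SS>, act = (\<lambda>g. restrict (act \<SS> g) (ground \<S>')), smat = \<S>'\<rparr>)"

definition action_contraction ::
  "('g, 'a) semimatroid_action \<Rightarrow> 'a \<Rightarrow> ('g, 'a) semimatroid_action" where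
  "action_contraction \<SS> s =
    (let \<S>' = contraction (smat \<SS>) {s}
     in \<lparr>grp = (grp \<SS>)\<lparr>carrier := stabilizer (grp \<SS>) (act \<SS>) s\<rparr>,
         act = (\<lambda>g. restrict (act \<SS> g) (ground \<S>')), smat = \<S>'\<rparr>)"

end

theory Submission
  imports Defs
begin

text \<open>Grouping by multiplicities hides that the Tutte polynomial is really a sum over orbits of
  central sets. In a translative action a central set meets every orbit of elements in at most
  one point, so \<open>X\<close> and \<open>underl \<SS> X\<close> have the same cardinality; combined with the augmentation
  axiom CR2 this also shows that they have the same rank. Hence \<open>tutte_poly \<SS> x y\<close> is the sum of
  \<open>(x - 1) ^ (r - rk X) * (y - 1) ^ (card X - rk X)\<close>, where \<open>r\<close> is the full rank and \<open>X\<close> runs through any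
  set of representatives of the orbits on central sets (\<open>tutte_poly_transversal\<close>).

  Fix a point \<open>s\<close> of the orbit \<open>e\<close>. Every central set that meets \<open>e\<close> can be moved so that it
  contains \<open>s\<close>, so there are representatives all of which either miss \<open>e\<close> or contain \<open>s\<close>. Those
  that miss \<open>e\<close> represent the orbits of the deletion. Those that contain \<open>s\<close>, with \<open>s\<close> removed,
  represent the orbits of the contraction under the stabilizer of \<open>s\<close>: a group element that moves
  one central set through \<open>s\<close> to another one fixes \<open>s\<close>, by translativity.

  Comparing exponents termwise gives one identity that covers all cases (\<open>tutte_poly_split\<close>):
  the deletion is weighted by \<open>x - 1\<close> to the drop in full rank caused by deleting \<open>e\<close>, and the
  contraction by \<open>y - 1\<close> to the nullity of \<open>{s}\<close>. The three cases of the theorem are the possible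
  values of these two exponents: the nullity is \<open>1\<close> exactly for loops, and the drop is \<open>1\<close> exactly
  for isthmuses. Of the latter, the implication that needs an argument is that a drop forces \<open>e\<close> to
  be an isthmus (\<open>isthmus_if_full_rank_deletion_less\<close>).\<close>

section \<open>Full rank\<close>

definition full_rank :: "'a ranked_triple \<Rightarrow> nat" where
  "full_rank \<S> = Max (rk \<S> ` central \<S>)"

context locally_ranked_triple
begin

lemma empty_central: "{} \<in> central \<S>"
  using central_nonempty central_down by blast

lemma rk_empty: "rk \<S> {} = 0"
  using R1[OF empty_central] by simp

lemma finite_rk_image: "finite (rk \<S> ` central \<S>)"
  using rk_bounded by (auto simp: finite_nat_set_iff_bounded_le)

lemma rk_le_full_rank: "X \<in> central \<S> \<Longrightarrow> rk \<S> X \<le> full_rank \<S>"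
  unfolding full_rank_def by (intro Max_ge finite_rk_image) auto

lemma full_rank_attained: "\<exists>X \<in> central \<S>. rk \<S> X = full_rank \<S>"
proof -
  have "full_rank \<S> \<in> rk \<S> ` central \<S>"
    unfolding full_rank_def using central_nonempty by (intro Max_in finite_rk_image) auto
  then show ?thesis by auto
qed

lemma rk_Un_le:
  assumes "X \<union> Y \<in> central \<S>"
  shows "rk \<S> (X \<union> Y) \<le> rk \<S> X + rk \<S> Y"
  using R3[of X Y] central_down[OF assms] assms by fastforce

end

text \<open>A largest central superset has full rank, since otherwise CR2 would enlarge it. Maximality has
  to be taken with respect to cardinality: a single step of CR2 may leave the rank unchanged.\<close>

lemma (in finitary_semimatroid) ex_full_rank_superset:
  assumes "X \<in> central \<S>"
  shows "\<exists>Z \<in> central \<S>. X \<subseteq> Z \<and> rk \<S> Z = full_rank \<S>"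
proof -
  let ?P = "\<lambda>Z. Z \<in> central \<S> \<and> X \<subseteq> Z"
  obtain n where n: "\<forall>X \<in> central \<S>. card X \<le> n"
    using central_card_bounded by auto
  obtain Z where Z: "?P Z" and max: "\<And>Y. ?P Y \<Longrightarrow> card Y \<le> card Z"
    using ex_has_greatest_nat[of ?P X card "Suc n"] assms n le_imp_less_Suc
    by blast
  obtain B where B: "B \<in> central \<S>" "rk \<S> B = full_rank \<S>"
    using full_rank_attained by blast
  have "rk \<S> Z = full_rank \<S>"
  proof (rule ccontr)
    assume "rk \<S> Z \<noteq> full_rank \<S>"
    then have "rk \<S> Z < rk \<S> B"
      using rk_le_full_rank[of Z] Z B by simp
    then obtain y where y: "y \<in> B - Z" "Z \<union> {y} \<in> central \<S>"
      using CR2 Z B by blast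
    then have "card (Z \<union> {y}) \<le> card Z"
      using Z by (intro max) auto
    then show False
      using y central_finite Z by auto
  qed
  then show ?thesis using Z by blast
qed

section \<open>Deletion and contraction of semimatroids\<close>

lemma deletion_sel [simp]:
  "ground (deletion \<S> T) = ground \<S> - T" "rk (deletion \<S> T) = rk \<S>"
  by (simp_all add: deletion_def)

lemma contraction_sel [simp]:
  "central (contraction \<S> X) = {Y \<in> central \<S>. Y \<inter> X = {} \<and> Y \<union> X \<in> central \<S>}"
  "ground (contraction \<S> X) = {s. {s} \<in> central (contraction \<S> X)}"
  "rk (contraction \<S> X) Y = rk \<S> (Y \<union> X) - rk \<S> X"
  by (simp_all add: contraction_def Let_def)

lemma (in locally_ranked_triple) central_deletion [simp]:
  "central (deletion \<S> T) = {X \<in> central \<S>. X \<inter> T = {}}"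
  using central_subset_ground by (auto simp: deletion_def)

context finitary_semimatroid
begin

lemma finitary_semimatroid_deletion: "finitary_semimatroid (deletion \<S> T)"
proof
  show "central (deletion \<S> T) \<noteq> {}"
    using empty_central by auto
  show "\<exists>n. \<forall>X \<in> central (deletion \<S> T). card X \<le> n"
    using central_card_bounded by auto
  show "\<exists>n. \<forall>X \<in> central (deletion \<S> T). rk (deletion \<S> T) X \<le> n"
    using rk_bounded by auto
next
  fix X Y assume "X \<in> central (deletion \<S> T)" "Y \<in> central (deletion \<S> T)"
    "rk (deletion \<S> T) X < rk (deletion \<S> T) Y"
  then show "\<exists>y \<in> Y - X. X \<union> {y} \<in> central (deletion \<S> T)"
    using CR2[of X Y] by auto
qed (use central_subset_ground central_finite central_singleton R1 R2 R3 CR1 in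
      \<open>auto intro: central_down\<close>)

lemma finitary_semimatroid_contraction:
  assumes X: "X \<in> central \<S>"
  shows "finitary_semimatroid (contraction \<S> X)"
proof -
  let ?K = "contraction \<S> X"
  have rk_ge: "rk \<S> X \<le> rk \<S> (Y \<union> X)" if "Y \<in> central ?K" for Y
    using that X by (auto intro: R2)
  show ?thesis
  proof
    show "central ?K \<noteq> {}"
      using X empty_central by auto
    show "\<exists>n. \<forall>Y \<in> central ?K. card Y \<le> n"
      using central_card_bounded by auto
    show "\<exists>n. \<forall>Y \<in> central ?K. rk ?K Y \<le> n"
    proof -
      obtain n where "\<forall>Y \<in> central \<S>. rk \<S> Y \<le> n"
        using rk_bounded by auto
      then have "\<forall>Y \<in> central ?K. rk ?K Y \<le> n"
        by (auto intro: order_trans[OF diff_le_self])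
      then show ?thesis by blast
    qed
  next
    fix Y Z assume Y: "Y \<in> central ?K" and "Z \<subseteq> Y"
    then show "Z \<in> central ?K"
      using central_down[of Y Z] central_down[of "Y \<union> X" "Z \<union> X"] by auto
  next
    fix Y assume Y: "Y \<in> central ?K"
    then show "finite Y" by (auto intro: central_finite)
    show "Y \<subseteq> ground ?K"
    proof
      fix s assume "s \<in> Y"
      then show "s \<in> ground ?K"
        using Y central_down[of Y "{s}"] central_down[of "Y \<union> X" "{s} \<union> X"] by auto
    qed
    show "rk ?K Y \<le> card Y"
      using rk_Un_le[of Y X] R1[of Y] Y by auto
  next
    fix Y Z assume YZ: "Y \<in> central ?K" "Z \<in> central ?K"
    have sets: "Y \<union> X \<in> central \<S>" "Z \<union> X \<in> central \<S>"
      and un: "(Y \<union> X) \<union> (Z \<union> X) = (Y \<union> Z) \<union> X"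
      and int: "(Y \<union> X) \<inter> (Z \<union> X) = (Y \<inter> Z) \<union> X"
      using YZ by auto
    have int_central: "(Y \<inter> Z) \<union> X \<in> central \<S>"
      using sets(1) by (rule central_down) auto
    then have int_ge: "rk \<S> X \<le> rk \<S> ((Y \<inter> Z) \<union> X)"
      using X by (intro R2) auto
    show "rk ?K Y \<le> rk ?K Z" if "Y \<subseteq> Z"
      using R2[OF sets] that by (auto intro: diff_le_mono)
    show "rk ?K (Y \<union> Z) + rk ?K (Y \<inter> Z) \<le> rk ?K Y + rk ?K Z" if "Y \<union> Z \<in> central ?K"
      using R3[OF sets] rk_ge[OF YZ(1)] rk_ge[OF YZ(2)] rk_ge[OF that] int_ge that
      by (simp add: un int)
    show "Y \<union> Z \<in> central ?K" if "rk ?K Y = rk ?K (Y \<inter> Z)"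
    proof -
      have "rk \<S> (Y \<union> X) = rk \<S> ((Y \<inter> Z) \<union> X)"
        using that rk_ge[OF YZ(1)] int_ge by simp
      then have *: "(Y \<union> Z) \<union> X \<in> central \<S>"
        using CR1[OF sets] by (simp add: un int)
      moreover have "Y \<union> Z \<in> central \<S>"
        using * by (rule central_down) auto
      ultimately show ?thesis using YZ by auto
    qed
    show "\<exists>z \<in> Z - Y. Y \<union> {z} \<in> central ?K" if "rk ?K Y < rk ?K Z"
    proof -
      have "rk \<S> (Y \<union> X) < rk \<S> (Z \<union> X)"
        using that by simp
      then obtain z where z: "z \<in> (Z \<union> X) - (Y \<union> X)" "(Y \<union> X) \<union> {z} \<in> central \<S>"
        using CR2[OF sets] by blast
      then have "Y \<union> {z} \<in> central \<S>"
        by (elim central_down) auto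
      moreover have "(Y \<union> {z}) \<union> X \<in> central \<S>"
        using z(2) by (simp add: Un_ac)
      ultimately have "Y \<union> {z} \<in> central ?K"
        using z YZ by auto
      then show ?thesis using z by blast
    qed
  qed auto
qed

text \<open>Since \<open>X\<close> extends to a central set of full rank, the sets that contain \<open>X\<close> already see the
  whole rank.\<close>

lemma full_rank_contraction:
  assumes X: "X \<in> central \<S>"
  shows "full_rank (contraction \<S> X) + rk \<S> X = full_rank \<S>"
proof -
  let ?K = "contraction \<S> X"
  interpret K: finitary_semimatroid ?K
    using X by (rule finitary_semimatroid_contraction)
  obtain Z where Z: "Z \<in> central \<S>" "X \<subseteq> Z" "rk \<S> Z = full_rank \<S>"
    using ex_full_rank_superset[OF X] by blast
  have "Z - X \<in> central ?K"
    using Z by (auto simp: Un_absorb2 intro: central_down)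
  then have "rk \<S> Z - rk \<S> X \<le> full_rank ?K"
    using K.rk_le_full_rank[of "Z - X"] Z by (simp add: Un_absorb2)
  moreover obtain Y where Y: "Y \<in> central ?K" "rk ?K Y = full_rank ?K"
    using K.full_rank_attained by blast
  moreover have "rk \<S> (Y \<union> X) \<le> full_rank \<S>" "rk \<S> X \<le> rk \<S> (Y \<union> X)"
    using Y X rk_le_full_rank[of "Y \<union> X"] by (auto intro: R2)
  ultimately show ?thesis
    using Z rk_le_full_rank[OF X] by simp
qed

end

section \<open>Translative actions\<close>

text \<open>This provides the actions on both minors: the whole group acts on the complement of an
  orbit, and the stabilizer of a point acts on the elements that are central together with it.\<close>

lemma (in group_action) group_action_restrict:
  assumes H: "subgroup H G" and F: "F \<subseteq> E"
    and inv: "\<And>h x. h \<in> H \<Longrightarrow> x \<in> F \<Longrightarrow> \<phi> h x \<in> F"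
  shows "group_action (G\<lparr>carrier := H\<rparr>) F (\<lambda>g. restrict (\<phi> g) F)"
proof -
  interpret group G
    using group_hom group_hom.axioms(1) by auto
  interpret H: subgroup H G by fact
  have Bij: "restrict (\<phi> h) F \<in> Bij F" if h: "h \<in> H" for h
  proof -
    have "inj_on (\<phi> h) F"
      using inj_prop[of h] h H.subset F by (meson inj_on_subset subsetD)
    moreover have "\<phi> h ` F = F"
    proof
      show "\<phi> h ` F \<subseteq> F" using inv h by auto
      show "F \<subseteq> \<phi> h ` F"
      proof
        fix x assume x: "x \<in> F"
        have "\<phi> h (\<phi> (inv h) x) = x"
          using orbit_sym_aux[of "inv h" x] h x F by (simp add: subset_iff)
        then show "x \<in> \<phi> h ` F"
          using inv[of "inv h" x] h x by (metis H.m_inv_closed imageI)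
      qed
    qed
    ultimately show ?thesis
      by (auto simp: Bij_def bij_betw_def inj_on_def)
  qed
  have "restrict (\<phi> (g \<otimes> h)) F = compose F (restrict (\<phi> g) F) (restrict (\<phi> h) F)"
    if "g \<in> H" "h \<in> H" for g h
    using that F inv H.subset
    by (intro ext) (auto simp: compose_def composition_rule subset_iff)
  then have "(\<lambda>g. restrict (\<phi> g) F) \<in> hom (G\<lparr>carrier := H\<rparr>) (BijGroup F)"
    using Bij by (auto simp: hom_def BijGroup_def)
  moreover have "group (G\<lparr>carrier := H\<rparr>)"
    using H by (rule subgroup_imp_group)
  ultimately show ?thesis
    by (intro group_action.intro group_hom.intro group_hom_axioms.intro group_BijGroup)
qed

text \<open>Choosing representatives once and for all turns sums over orbits of central sets, in \<open>\<SS>\<close> and in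
  its minors, into sums over sets of central sets, which can be split and reindexed directly.\<close>

definition transversal :: "('g, 'a) semimatroid_action \<Rightarrow> 'a set set \<Rightarrow> bool" where
  "transversal \<SS> R \<longleftrightarrow> R \<subseteq> central (smat \<SS>) \<and>
    (\<forall>X \<in> central (smat \<SS>). \<exists>g \<in> carrier (grp \<SS>). act \<SS> g ` X \<in> R) \<and>
    (\<forall>X \<in> R. \<forall>g \<in> carrier (grp \<SS>). act \<SS> g ` X \<in> R \<longrightarrow> act \<SS> g ` X = X)"

lemma transversalI:
  assumes "\<And>X. X \<in> R \<Longrightarrow> X \<in> central (smat \<SS>)"
    and "\<And>X. X \<in> central (smat \<SS>) \<Longrightarrow> \<exists>g \<in> carrier (grp \<SS>). act \<SS> g ` X \<in> R"
    and "\<And>X g. X \<in> R \<Longrightarrow> g \<in> carrier (grp \<SS>) \<Longrightarrow> act \<SS> g ` X \<in> R \<Longrightarrow> act \<SS> g ` X = X"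
  shows "transversal \<SS> R"
  using assms unfolding transversal_def by blast

abbreviation set_orbit :: "('g, 'a) semimatroid_action \<Rightarrow> 'a set \<Rightarrow> 'a set set" where
  "set_orbit \<SS> X \<equiv> orbit (grp \<SS>) (\<lambda>g X. act \<SS> g ` X) X"

context G_semimatroid
begin

lemma group_grp: "group (grp \<SS>)"
  using group_hom group_hom.axioms(1) by auto

lemma orbit_act:
  assumes "g \<in> carrier (grp \<SS>)" "x \<in> ground (smat \<SS>)"
  shows "orbit (grp \<SS>) (act \<SS>) (act \<SS> g x) = orbit (grp \<SS>) (act \<SS>) x"
proof -
  have y: "act \<SS> g x \<in> ground (smat \<SS>)" "act \<SS> g x \<in> orbit (grp \<SS>) (act \<SS>) x"
    using element_image[OF assms] assms by (auto simp: orbit_def)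
  have sub: "orbit (grp \<SS>) (act \<SS>) z \<subseteq> ground (smat \<SS>)" if "z \<in> ground (smat \<SS>)" for z
    using that element_image by (auto simp: orbit_def)
  show ?thesis
    using orbit_trans[of x "act \<SS> g x"] orbit_trans[of "act \<SS> g x" x] orbit_sym[of x "act \<SS> g x"]
      y sub assms by blast
qed

lemma underl_act:
  assumes "g \<in> carrier (grp \<SS>)" "X \<in> central (smat \<SS>)"
  shows "underl \<SS> (act \<SS> g ` X) = underl \<SS> X"
proof -
  have "\<And>x. x \<in> X \<Longrightarrow> orbit (grp \<SS>) (act \<SS>) (act \<SS> g x) = orbit (grp \<SS>) (act \<SS>) x"
    using central_subset_ground[OF assms(2)] by (intro orbit_act assms(1)) auto
  then show ?thesis
    unfolding underl_def image_image by (rule image_cong[OF refl])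
qed

lemma act_mult_image:
  assumes "g \<in> carrier (grp \<SS>)" "h \<in> carrier (grp \<SS>)" "X \<in> central (smat \<SS>)"
  shows "act \<SS> (g \<otimes>\<^bsub>grp \<SS>\<^esub> h) ` X = act \<SS> g ` act \<SS> h ` X"
  using central_subset_ground[OF assms(3)]
  by (force simp: image_image composition_rule assms(1,2) intro!: image_cong)

lemma set_orbit_act:
  assumes g: "g \<in> carrier (grp \<SS>)" and X: "X \<in> central (smat \<SS>)"
  shows "set_orbit \<SS> (act \<SS> g ` X) = set_orbit \<SS> X"
proof -
  interpret group "grp \<SS>" by (rule group_grp)
  have "act \<SS> h ` act \<SS> g ` X \<in> set_orbit \<SS> X" if "h \<in> carrier (grp \<SS>)" for h
    using act_mult_image[OF that g X] that g unfolding orbit_def by blast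
  moreover have "act \<SS> h ` X \<in> set_orbit \<SS> (act \<SS> g ` X)" if h: "h \<in> carrier (grp \<SS>)" for h
  proof -
    let ?k = "h \<otimes>\<^bsub>grp \<SS>\<^esub> inv\<^bsub>grp \<SS>\<^esub> g"
    have k: "?k \<in> carrier (grp \<SS>)" "?k \<otimes>\<^bsub>grp \<SS>\<^esub> g = h"
      using g h by (simp_all add: m_assoc)
    then have "act \<SS> h ` X = act \<SS> ?k ` act \<SS> g ` X"
      using act_mult_image[OF k(1) g X] by simp
    then show ?thesis using k(1) unfolding orbit_def by blast
  qed
  ultimately show ?thesis unfolding orbit_def by blast
qed

lemma set_orbit_refl:
  assumes "X \<in> central (smat \<SS>)"
  shows "X \<in> set_orbit \<SS> X"
proof -
  have "act \<SS> \<one>\<^bsub>grp \<SS>\<^esub> ` X = X"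
    using central_subset_ground[OF assms] by (force simp: id_eq_one[symmetric])
  moreover have "\<one>\<^bsub>grp \<SS>\<^esub> \<in> carrier (grp \<SS>)"
    using group_grp group.is_monoid monoid.one_closed by blast
  ultimately show ?thesis unfolding orbit_def by blast
qed

text \<open>The predicate \<open>P\<close> is a normal form that can be demanded of the representatives as soon as
  every orbit contains a set in normal form.\<close>

lemma ex_transversal:
  assumes cofin: "cofinite_action \<SS>"
    and P: "\<And>X. X \<in> central (smat \<SS>) \<Longrightarrow> \<exists>g \<in> carrier (grp \<SS>). P (act \<SS> g ` X)"
  shows "\<exists>R. finite R \<and> transversal \<SS> R \<and> (\<forall>X \<in> R. P X)"
proof -
  let ?C = "central (smat \<SS>)"
  let ?O = "set_orbits \<SS> ?C"
  have "\<forall>Q \<in> ?O. \<exists>X. X \<in> Q \<and> P X"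
    using P unfolding set_orbits_def orbits_def orbit_def by blast
  then obtain f where f: "\<And>Q. Q \<in> ?O \<Longrightarrow> f Q \<in> Q \<and> P (f Q)"
    by metis
  have f_central: "f Q \<in> ?C" and f_orbit: "set_orbit \<SS> (f Q) = Q" if Q: "Q \<in> ?O" for Q
  proof -
    obtain X where X: "X \<in> ?C" "Q = set_orbit \<SS> X"
      using Q unfolding set_orbits_def orbits_def by blast
    then obtain g where g: "g \<in> carrier (grp \<SS>)" "f Q = act \<SS> g ` X"
      using f[OF Q] unfolding orbit_def by blast
    show "f Q \<in> ?C" "set_orbit \<SS> (f Q) = Q"
      using X g act_central set_orbit_act by simp_all
  qed
  have "transversal \<SS> (f ` ?O)"
  proof (rule transversalI)
    fix X assume "X \<in> ?C"
    then have "set_orbit \<SS> X \<in> ?O"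
      unfolding set_orbits_def orbits_def by blast
    moreover from f[OF this] obtain g where "g \<in> carrier (grp \<SS>)" "f (set_orbit \<SS> X) = act \<SS> g ` X"
      unfolding orbit_def by blast
    ultimately show "\<exists>g \<in> carrier (grp \<SS>). act \<SS> g ` X \<in> f ` ?O"
      by (metis imageI)
  next
    fix X g assume "X \<in> f ` ?O" and g: "g \<in> carrier (grp \<SS>)" and "act \<SS> g ` X \<in> f ` ?O"
    then obtain Q Q' where Q: "Q \<in> ?O" "X = f Q" and Q': "Q' \<in> ?O" "act \<SS> g ` X = f Q'"
      by blast
    have "Q' = set_orbit \<SS> (act \<SS> g ` X)"
      using f_orbit[OF Q'(1)] Q'(2) by simp
    also have "\<dots> = set_orbit \<SS> X"
      using g f_central[OF Q(1)] Q(2) set_orbit_act by simp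
    also have "\<dots> = Q"
      using f_orbit[OF Q(1)] Q(2) by simp
    finally show "act \<SS> g ` X = X"
      using Q(2) Q'(2) by simp
  qed (use f_central in auto)
  moreover have "finite (f ` ?O)"
    using cofin by (simp add: cofinite_action_def)
  ultimately show ?thesis using f by blast
qed

lemma multiplicity_transversal:
  assumes R: "transversal \<SS> R"
  shows "multiplicity \<SS> A = card {X \<in> R. underl \<SS> X = A}"
proof -
  let ?RA = "{X \<in> R. underl \<SS> X = A}"
  have R_central: "X \<in> R \<Longrightarrow> X \<in> central (smat \<SS>)" for X
    using R by (auto simp: transversal_def)
  have "set_orbits \<SS> {X \<in> central (smat \<SS>). underl \<SS> X = A} = set_orbit \<SS> ` ?RA" (is "?L = ?M")
  proof
    show "?L \<subseteq> ?M"
    proof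
      fix Q assume "Q \<in> ?L"
      then obtain X where X: "X \<in> central (smat \<SS>)" "underl \<SS> X = A" "Q = set_orbit \<SS> X"
        by (auto simp: set_orbits_def orbits_def)
      obtain g where g: "g \<in> carrier (grp \<SS>)" "act \<SS> g ` X \<in> R"
        using R X(1) unfolding transversal_def by blast
      have "Q = set_orbit \<SS> (act \<SS> g ` X)"
        using set_orbit_act[OF g(1) X(1)] X(3) by simp
      moreover have "act \<SS> g ` X \<in> ?RA"
        using g X underl_act by simp
      ultimately show "Q \<in> ?M" by blast
    qed
    show "?M \<subseteq> ?L"
      using R_central by (auto simp: set_orbits_def orbits_def)
  qed
  moreover have "inj_on (set_orbit \<SS>) ?RA"
  proof (rule inj_onI)
    fix X Y assume X: "X \<in> ?RA" and Y: "Y \<in> ?RA" and eq: "set_orbit \<SS> X = set_orbit \<SS> Y"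
    have "Y \<in> set_orbit \<SS> X"
      using set_orbit_refl[of Y] R_central[of Y] Y eq by simp
    then obtain g where "g \<in> carrier (grp \<SS>)" "Y = act \<SS> g ` X"
      by (auto simp: orbit_def)
    then show "X = Y"
      using R X Y unfolding transversal_def by blast
  qed
  ultimately show ?thesis
    unfolding multiplicity_def by (simp add: card_image)
qed

end

locale translative_G_semimatroid = G_semimatroid +
  assumes translative: "translative \<SS>"
begin

lemma act_eq_of_central:
  assumes "X \<in> central (smat \<SS>)" "x \<in> X" "act \<SS> g x \<in> X" "g \<in> carrier (grp \<SS>)"
  shows "act \<SS> g x = x"
proof -
  have "{x, act \<SS> g x} \<in> central (smat \<SS>)" "x \<in> ground (smat \<SS>)"
    using assms central_down[of X] central_subset_ground by auto
  then show ?thesis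
    using translative assms(4) unfolding translative_def by blast
qed

lemma orbit_inj_on_central:
  assumes X: "X \<in> central (smat \<SS>)"
  shows "inj_on (orbit (grp \<SS>) (act \<SS>)) X"
proof (rule inj_onI)
  fix a b assume ab: "a \<in> X" "b \<in> X" "orbit (grp \<SS>) (act \<SS>) a = orbit (grp \<SS>) (act \<SS>) b"
  then have "b \<in> orbit (grp \<SS>) (act \<SS>) a"
    using orbit_refl[of b] central_subset_ground[OF X] by auto
  then obtain g where "g \<in> carrier (grp \<SS>)" "b = act \<SS> g a"
    by (auto simp: orbit_def)
  then show "a = b"
    using act_eq_of_central[OF X, of a g] ab by simp
qed

lemma card_underl: "X \<in> central (smat \<SS>) \<Longrightarrow> card (underl \<SS> X) = card X"
  unfolding underl_def by (intro card_image orbit_inj_on_central)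

text \<open>If the rank of \<open>Y\<close> were larger, CR2 would add to \<open>X\<close> some \<open>y\<close> outside \<open>X\<close>. But \<open>y\<close> lies in the
  orbit of a point of \<open>X\<close>, and no central set contains two points of one orbit.\<close>

lemma rk_le_of_underl_subset:
  assumes X: "X \<in> central (smat \<SS>)" and Y: "Y \<in> central (smat \<SS>)"
    and sub: "underl \<SS> Y \<subseteq> underl \<SS> X"
  shows "rk (smat \<SS>) Y \<le> rk (smat \<SS>) X"
proof (rule ccontr)
  assume "\<not> ?thesis"
  then obtain y where y: "y \<in> Y - X" "X \<union> {y} \<in> central (smat \<SS>)"
    using CR2[OF X Y] by auto
  then obtain x where x: "x \<in> X" "orbit (grp \<SS>) (act \<SS>) y = orbit (grp \<SS>) (act \<SS>) x"
    using sub unfolding underl_def by blast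
  then show False
    using orbit_inj_on_central[OF y(2)] y by (auto simp: inj_on_def)
qed

lemma rk_orbit_triple_underl:
  assumes X: "X \<in> central (smat \<SS>)"
  shows "rk (orbit_triple \<SS>) (underl \<SS> X) = rk (smat \<SS>) X"
proof -
  have "finite {rk (smat \<SS>) Y | Y. Y \<in> central (smat \<SS>) \<and> underl \<SS> Y \<subseteq> underl \<SS> X}"
    by (rule finite_subset[OF _ finite_rk_image]) auto
  then have "Max {rk (smat \<SS>) Y | Y. Y \<in> central (smat \<SS>) \<and> underl \<SS> Y \<subseteq> underl \<SS> X} = rk (smat \<SS>) X"
    using X rk_le_of_underl_subset[OF X] by (intro Max_eqI) auto
  then show ?thesis by (simp add: orbit_triple_def)
qed

lemma rk_orbit_triple_ground: "rk (orbit_triple \<SS>) (ground (orbit_triple \<SS>)) = full_rank (smat \<SS>)"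
proof -
  have "underl \<SS> X \<subseteq> orbits (grp \<SS>) (ground (smat \<SS>)) (act \<SS>)" if "X \<in> central (smat \<SS>)" for X
    using central_subset_ground[OF that] by (auto simp: underl_def orbits_def)
  then have "{rk (smat \<SS>) X | X. X \<in> central (smat \<SS>) \<and> underl \<SS> X \<subseteq> orbits (grp \<SS>) (ground (smat \<SS>)) (act \<SS>)}
    = rk (smat \<SS>) ` central (smat \<SS>)"
    by auto
  then show ?thesis by (simp add: orbit_triple_def full_rank_def)
qed

text \<open>The multiplicity of \<open>A\<close> counts the representatives above \<open>A\<close>, and the summand depends only
  on the rank and cardinality of \<open>A\<close>, which can be read off from any set above it.\<close>

lemma tutte_poly_transversal:
  fixes x y :: "'r::comm_ring_1"
  assumes fin: "finite R" and R: "transversal \<SS> R"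
  shows "tutte_poly \<SS> x y = (\<Sum>X \<in> R. (x - 1) ^ (full_rank (smat \<SS>) - rk (smat \<SS>) X)
    * (y - 1) ^ (card X - rk (smat \<SS>) X))"
proof -
  let ?t = "\<lambda>A. (x - 1) ^ (full_rank (smat \<SS>) - rk (orbit_triple \<SS>) A)
    * (y - 1) ^ (card A - rk (orbit_triple \<SS>) A)"
  have R_central: "X \<in> R \<Longrightarrow> X \<in> central (smat \<SS>)" for X
    using R by (auto simp: transversal_def)
  have "underl \<SS> X \<in> underl \<SS> ` R" if X: "X \<in> central (smat \<SS>)" for X
  proof -
    obtain g where "g \<in> carrier (grp \<SS>)" "act \<SS> g ` X \<in> R"
      using R X unfolding transversal_def by blast
    then show ?thesis
      using underl_act[OF _ X] by (metis imageI)
  qed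
  then have image: "underl \<SS> ` central (smat \<SS>) = underl \<SS> ` R"
    using R_central by blast
  have "tutte_poly \<SS> x y = (\<Sum>A \<in> underl \<SS> ` R. of_nat (multiplicity \<SS> A) * ?t A)"
    unfolding tutte_poly_def Let_def rk_orbit_triple_ground
    by (simp add: orbit_triple_def image mult.assoc)
  also have "\<dots> = (\<Sum>A \<in> underl \<SS> ` R. \<Sum>X \<in> {X \<in> R. underl \<SS> X = A}. ?t (underl \<SS> X))"
    by (intro sum.cong refl) (simp add: multiplicity_transversal[OF R])
  also have "\<dots> = (\<Sum>X \<in> R. ?t (underl \<SS> X))"
    by (rule sum.image_gen[symmetric, OF fin])
  also have "\<dots> = (\<Sum>X \<in> R. (x - 1) ^ (full_rank (smat \<SS>) - rk (smat \<SS>) X)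
    * (y - 1) ^ (card X - rk (smat \<SS>) X))"
    by (intro sum.cong refl) (simp add: R_central rk_orbit_triple_underl card_underl)
  finally show ?thesis .
qed

end

section \<open>Minors of translative actions\<close>

lemma action_deletion_sel [simp]:
  "grp (action_deletion \<SS> e) = grp \<SS>"
  "smat (action_deletion \<SS> e) = deletion (smat \<SS>) e"
  "act (action_deletion \<SS> e) g = restrict (act \<SS> g) (ground (deletion (smat \<SS>) e))"
  by (simp_all add: action_deletion_def Let_def)

lemma action_contraction_sel [simp]:
  "carrier (grp (action_contraction \<SS> s)) = stabilizer (grp \<SS>) (act \<SS>) s"
  "smat (action_contraction \<SS> s) = contraction (smat \<SS>) {s}"
  "act (action_contraction \<SS> s) g = restrict (act \<SS> g) (ground (contraction (smat \<SS>) {s}))"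
  by (simp_all add: action_contraction_def Let_def)

context translative_G_semimatroid
begin

lemma mem_orbit_iff:
  assumes e: "e \<in> orbits (grp \<SS>) (ground (smat \<SS>)) (act \<SS>)"
    and z: "z \<in> ground (smat \<SS>)"
  shows "z \<in> e \<longleftrightarrow> orbit (grp \<SS>) (act \<SS>) z = e"
  using disjoint_union[of "orbit (grp \<SS>) (act \<SS>) z" e] e orbit_refl[OF z] z
  by (auto simp: orbits_def)

lemma act_in_orbit_iff:
  assumes e: "e \<in> orbits (grp \<SS>) (ground (smat \<SS>)) (act \<SS>)"
    and g: "g \<in> carrier (grp \<SS>)" and x: "x \<in> ground (smat \<SS>)"
  shows "act \<SS> g x \<in> e \<longleftrightarrow> x \<in> e"
  using mem_orbit_iff[OF e] orbit_act[OF g x] element_image[OF g x] x by simp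

lemma act_image_meets_orbit_iff:
  assumes "e \<in> orbits (grp \<SS>) (ground (smat \<SS>)) (act \<SS>)"
    and "g \<in> carrier (grp \<SS>)" and "X \<in> central (smat \<SS>)"
  shows "act \<SS> g ` X \<inter> e = {} \<longleftrightarrow> X \<inter> e = {}"
  using act_in_orbit_iff[OF assms(1,2)] central_subset_ground[OF assms(3)] by blast

lemma central_deletion_act_image:
  assumes "X \<in> central (smat (action_deletion \<SS> e))"
  shows "act (action_deletion \<SS> e) g ` X = act \<SS> g ` X"
proof (rule image_cong[OF refl])
  fix x assume "x \<in> X"
  then have "x \<in> ground (deletion (smat \<SS>) e)"
    using assms central_subset_ground[of X] by auto
  then show "act (action_deletion \<SS> e) g x = act \<SS> g x"
    by simp
qed

lemma translative_G_semimatroid_deletion: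
  assumes e: "e \<in> orbits (grp \<SS>) (ground (smat \<SS>)) (act \<SS>)"
  shows "translative_G_semimatroid (action_deletion \<SS> e)"
proof -
  interpret group "grp \<SS>" by (rule group_grp)
  interpret D: finitary_semimatroid "smat (action_deletion \<SS> e)"
    by (simp add: finitary_semimatroid_deletion)
  have "group_action ((grp \<SS>)\<lparr>carrier := carrier (grp \<SS>)\<rparr>) (ground (deletion (smat \<SS>) e))
      (\<lambda>g. restrict (act \<SS> g) (ground (deletion (smat \<SS>) e)))"
  proof (intro group_action_restrict subgroup_self)
    show "act \<SS> h x \<in> ground (deletion (smat \<SS>) e)"
      if "h \<in> carrier (grp \<SS>)" "x \<in> ground (deletion (smat \<SS>) e)" for h x
      using act_in_orbit_iff[OF e, of h x] element_image[of h x, OF _ _ refl] that by simp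
  qed simp
  moreover have "act (action_deletion \<SS> e) = (\<lambda>g. restrict (act \<SS> g) (ground (deletion (smat \<SS>) e)))"
    by (intro ext) simp
  ultimately interpret D: group_action "grp (action_deletion \<SS> e)"
      "ground (smat (action_deletion \<SS> e))" "act (action_deletion \<SS> e)"
    by simp
  show ?thesis
  proof
    fix g X assume g: "g \<in> carrier (grp (action_deletion \<SS> e))"
      and X: "X \<in> central (smat (action_deletion \<SS> e))"
    show "act (action_deletion \<SS> e) g ` X \<in> central (smat (action_deletion \<SS> e))"
      unfolding central_deletion_act_image[OF X]
      using act_central act_image_meets_orbit_iff[OF e] g X by simp
    show "rk (smat (action_deletion \<SS> e)) (act (action_deletion \<SS> e) g ` X)
        = rk (smat (action_deletion \<SS> e)) X"
      unfolding central_deletion_act_image[OF X] using act_rk g X by simp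
  next
    show "translative (action_deletion \<SS> e)"
      using translative by (auto simp: translative_def)
  qed
qed

lemma transversal_deletion:
  assumes e: "e \<in> orbits (grp \<SS>) (ground (smat \<SS>)) (act \<SS>)" and R: "transversal \<SS> R"
  shows "transversal (action_deletion \<SS> e) {X \<in> R. X \<inter> e = {}}" (is "transversal ?D ?R0")
proof (rule transversalI)
  show R0: "X \<in> central (smat ?D)" if "X \<in> ?R0" for X
    using that R by (auto simp: transversal_def)
  show "\<exists>g \<in> carrier (grp ?D). act ?D g ` X \<in> ?R0" if X: "X \<in> central (smat ?D)" for X
  proof -
    have X': "X \<in> central (smat \<SS>)" "X \<inter> e = {}"
      using X by simp_all
    then obtain g where g: "g \<in> carrier (grp \<SS>)" "act \<SS> g ` X \<in> R"
      using R unfolding transversal_def by blast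
    then have "act ?D g ` X \<in> ?R0"
      unfolding central_deletion_act_image[OF X]
      using act_image_meets_orbit_iff[OF e g(1) X'(1)] X'(2) by simp
    then show ?thesis using g by auto
  qed
  show "act ?D g ` X = X"
    if X: "X \<in> ?R0" and g: "g \<in> carrier (grp ?D)" and gX: "act ?D g ` X \<in> ?R0" for X g
    using R X g gX unfolding central_deletion_act_image[OF R0[OF X]] transversal_def by simp
qed

lemma central_contraction_act_image:
  assumes s: "s \<in> ground (smat \<SS>)" and Y: "Y \<in> central (contraction (smat \<SS>) {s})"
  shows "act (action_contraction \<SS> s) g ` Y = act \<SS> g ` Y"
proof -
  interpret K: finitary_semimatroid "contraction (smat \<SS>) {s}"
    using s by (intro finitary_semimatroid_contraction central_singleton)
  show ?thesis
    using K.central_subset_ground[OF Y] unfolding action_contraction_sel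
    by (intro image_cong) (auto simp only: restrict_apply split: if_splits)
qed

lemma stabilizer_act_contraction:
  assumes s: "s \<in> ground (smat \<SS>)" and g: "g \<in> stabilizer (grp \<SS>) (act \<SS>) s"
    and Y: "Y \<in> central (contraction (smat \<SS>) {s})"
  shows "act \<SS> g ` Y \<in> central (contraction (smat \<SS>) {s})"
    and "act \<SS> g ` Y \<union> {s} = act \<SS> g ` (Y \<union> {s})"
proof -
  have g': "g \<in> carrier (grp \<SS>)" "act \<SS> g s = s"
    using g by (auto simp: stabilizer_def)
  show eq: "act \<SS> g ` Y \<union> {s} = act \<SS> g ` (Y \<union> {s})"
    using g' by simp
  have "s \<notin> act \<SS> g ` Y"
  proof
    assume "s \<in> act \<SS> g ` Y"
    then obtain y where y: "y \<in> Y" "act \<SS> g y = act \<SS> g s"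
      using g' by auto
    moreover have "y \<in> ground (smat \<SS>)"
      using Y y central_subset_ground by auto
    ultimately have "y = s"
      using inj_prop[OF g'(1)] s by (auto dest: inj_onD)
    then show False using y Y by auto
  qed
  moreover have "act \<SS> g ` Y \<union> {s} \<in> central (smat \<SS>)"
    unfolding eq using Y g' by (intro act_central) auto
  ultimately show "act \<SS> g ` Y \<in> central (contraction (smat \<SS>) {s})"
    using act_central[OF g'(1)] Y by auto
qed

lemma translative_G_semimatroid_contraction:
  assumes s: "s \<in> ground (smat \<SS>)"
  shows "translative_G_semimatroid (action_contraction \<SS> s)"
proof -
  let ?K = "contraction (smat \<SS>) {s}"
  interpret group "grp \<SS>" by (rule group_grp)
  interpret D: finitary_semimatroid "smat (action_contraction \<SS> s)"
    using s by (simp add: finitary_semimatroid_contraction central_singleton del: contraction_sel)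
  have "group_action ((grp \<SS>)\<lparr>carrier := stabilizer (grp \<SS>) (act \<SS>) s\<rparr>) (ground ?K)
      (\<lambda>g. restrict (act \<SS> g) (ground ?K))"
  proof (intro group_action_restrict stabilizer_subgroup s)
    show "ground ?K \<subseteq> ground (smat \<SS>)"
      using central_subset_ground by auto
    show "act \<SS> h x \<in> ground ?K" if "h \<in> stabilizer (grp \<SS>) (act \<SS>) s" "x \<in> ground ?K" for h x
      using stabilizer_act_contraction(1)[OF s that(1), of "{x}"] that(2) by simp
  qed
  moreover have "act (action_contraction \<SS> s) = (\<lambda>g. restrict (act \<SS> g) (ground ?K))"
    by (intro ext) (simp del: contraction_sel)
  moreover have "grp (action_contraction \<SS> s) = (grp \<SS>)\<lparr>carrier := stabilizer (grp \<SS>) (act \<SS>) s\<rparr>"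
    by (simp add: action_contraction_def Let_def)
  ultimately interpret D: group_action "grp (action_contraction \<SS> s)"
      "ground (smat (action_contraction \<SS> s))" "act (action_contraction \<SS> s)"
    by (simp del: contraction_sel)
  show ?thesis
  proof
    fix g X assume g: "g \<in> carrier (grp (action_contraction \<SS> s))"
      and X: "X \<in> central (smat (action_contraction \<SS> s))"
    have g': "g \<in> stabilizer (grp \<SS>) (act \<SS>) s" "g \<in> carrier (grp \<SS>)"
      using g by (simp_all add: stabilizer_def)
    have X': "X \<in> central ?K" "X \<union> {s} \<in> central (smat \<SS>)"
      using X by simp_all
    show "act (action_contraction \<SS> s) g ` X \<in> central (smat (action_contraction \<SS> s))"
      unfolding central_contraction_act_image[OF s X'(1)] unfolding action_contraction_sel
      by (rule stabilizer_act_contraction(1)[OF s g'(1) X'(1)])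
    show "rk (smat (action_contraction \<SS> s)) (act (action_contraction \<SS> s) g ` X)
        = rk (smat (action_contraction \<SS> s)) X"
      unfolding central_contraction_act_image[OF s X'(1)]
      unfolding action_contraction_sel contraction_sel stabilizer_act_contraction(2)[OF s g'(1) X'(1)]
      using act_rk[OF g'(2) X'(2)] by simp
  next
    show "translative (action_contraction \<SS> s)"
      unfolding translative_def
    proof (intro ballI impI)
      fix g x assume g: "g \<in> carrier (grp (action_contraction \<SS> s))"
        and x: "x \<in> ground (smat (action_contraction \<SS> s))"
        and c: "{x, act (action_contraction \<SS> s) g x} \<in> central (smat (action_contraction \<SS> s))"
      have "act (action_contraction \<SS> s) g x = act \<SS> g x"
        using x by simp
      then show "act (action_contraction \<SS> s) g x = x"
        using act_eq_of_central[of "{x, act \<SS> g x}" x g] c g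
        by (simp add: stabilizer_def)
    qed
  qed
qed

text \<open>If \<open>g\<close> moves \<open>Y \<union> {s}\<close> to its representative, then the representative contains both \<open>s\<close> and
  the image of \<open>s\<close>. Translativity puts \<open>g\<close> in the stabilizer of \<open>s\<close>, so that \<open>Y\<close> and the
  representative without \<open>s\<close> are equivalent in the contraction.\<close>

lemma transversal_contraction:
  assumes e: "e \<in> orbits (grp \<SS>) (ground (smat \<SS>)) (act \<SS>)" and s: "s \<in> e"
    and R: "transversal \<SS> R" and Rs: "\<And>X. X \<in> R \<Longrightarrow> X \<inter> e \<noteq> {} \<Longrightarrow> s \<in> X"
  shows "transversal (action_contraction \<SS> s) ((\<lambda>X. X - {s}) ` {X \<in> R. s \<in> X})"
    (is "transversal ?K ?R1")
proof (rule transversalI)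
  have sg: "s \<in> ground (smat \<SS>)"
    using s e orbits_coverture by blast
  show R1: "X \<in> central (smat ?K)" if "X \<in> ?R1" for X
    using that R by (auto simp: transversal_def insert_absorb intro: central_down)
  show "\<exists>g \<in> carrier (grp ?K). act ?K g ` Y \<in> ?R1" if Y: "Y \<in> central (smat ?K)" for Y
  proof -
    have Y': "Y \<in> central (contraction (smat \<SS>) {s})"
      and Ys: "Y \<union> {s} \<in> central (smat \<SS>)" "s \<notin> Y"
      using Y by simp_all
    obtain g where g: "g \<in> carrier (grp \<SS>)" "act \<SS> g ` (Y \<union> {s}) \<in> R"
      using R Ys unfolding transversal_def by blast
    have "s \<in> act \<SS> g ` (Y \<union> {s})"
      using act_image_meets_orbit_iff[OF e g(1) Ys(1)] s by (intro Rs g(2)) blast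
    then have "act \<SS> g s = s"
      using act_eq_of_central[of "act \<SS> g ` (Y \<union> {s})" s g] act_central[OF g(1) Ys(1)] g(1)
      by simp
    then have gs: "g \<in> stabilizer (grp \<SS>) (act \<SS>) s"
      using g by (simp add: stabilizer_def)
    have "act \<SS> g ` Y \<union> {s} \<in> R"
      using stabilizer_act_contraction(2)[OF sg gs Y'] g(2) by simp
    moreover have "s \<notin> act \<SS> g ` Y"
      using stabilizer_act_contraction(1)[OF sg gs Y'] by simp
    then have "act \<SS> g ` Y = (act \<SS> g ` Y \<union> {s}) - {s}"
      by auto
    ultimately have "act \<SS> g ` Y \<in> ?R1"
      by blast
    then show ?thesis
      using gs unfolding central_contraction_act_image[OF sg Y', symmetric] by auto
  qed
  show "act ?K g ` Y = Y"
    if Y: "Y \<in> ?R1" and g: "g \<in> carrier (grp ?K)" and gY: "act ?K g ` Y \<in> ?R1" for Y g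
  proof -
    have Y': "Y \<in> central (contraction (smat \<SS>) {s})"
      using R1[OF Y] by simp
    have gs: "g \<in> stabilizer (grp \<SS>) (act \<SS>) s"
      using g by simp
    have R1_iff: "Z \<union> {s} \<in> R \<and> s \<notin> Z" if "Z \<in> ?R1" for Z
      using that by (auto simp: insert_absorb)
    have gY': "act \<SS> g ` Y \<in> ?R1"
      using gY unfolding central_contraction_act_image[OF sg Y'] .
    have "act \<SS> g ` (Y \<union> {s}) \<in> R"
      using R1_iff[OF gY'] unfolding stabilizer_act_contraction(2)[OF sg gs Y'] by blast
    then have "act \<SS> g ` (Y \<union> {s}) = Y \<union> {s}"
      using R R1_iff[OF Y] gs unfolding transversal_def stabilizer_def by blast
    then have "act \<SS> g ` Y \<union> {s} = Y \<union> {s}" "s \<notin> act \<SS> g ` Y" "s \<notin> Y"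
      using R1_iff[OF gY'] R1_iff[OF Y] stabilizer_act_contraction(2)[OF sg gs Y'] by simp_all
    then have "act \<SS> g ` Y = Y" by auto
    then show ?thesis
      unfolding central_contraction_act_image[OF sg Y'] .
  qed
qed

section \<open>The effect of an orbit on the full rank\<close>

lemma full_rank_deletion_le: "full_rank (deletion (smat \<SS>) e) \<le> full_rank (smat \<SS>)"
proof -
  interpret D: finitary_semimatroid "deletion (smat \<SS>) e"
    by (rule finitary_semimatroid_deletion)
  obtain X where "X \<in> central (deletion (smat \<SS>) e)"
    "rk (deletion (smat \<SS>) e) X = full_rank (deletion (smat \<SS>) e)"
    using D.full_rank_attained by blast
  then show ?thesis
    using rk_le_full_rank[of X] by simp
qed

lemma central_diff_orbit:
  assumes e: "e \<in> orbits (grp \<SS>) (ground (smat \<SS>)) (act \<SS>)"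
    and X: "X \<in> central (smat \<SS>)" and s: "s \<in> X" "s \<in> e"
  shows "(X - {s}) \<inter> e = {}"
  using orbit_inj_on_central[OF X] central_subset_ground[OF X] mem_orbit_iff[OF e] s
  by (force simp: inj_on_def subset_iff)

lemma underl_singleton:
  assumes e: "e \<in> orbits (grp \<SS>) (ground (smat \<SS>)) (act \<SS>)" and s: "s \<in> e"
  shows "underl \<SS> {s} = {e}" and "s \<in> ground (smat \<SS>)"
proof -
  show "s \<in> ground (smat \<SS>)"
    using e s orbits_coverture by blast
  then show "underl \<SS> {s} = {e}"
    using mem_orbit_iff[OF e] s by (simp add: underl_def)
qed

lemma rk_orbit_triple_singleton:
  assumes e: "e \<in> orbits (grp \<SS>) (ground (smat \<SS>)) (act \<SS>)" and s: "s \<in> e"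
  shows "rk (orbit_triple \<SS>) {e} = rk (smat \<SS>) {s}"
  using rk_orbit_triple_underl[OF central_singleton[OF underl_singleton(2)[OF assms]]]
  by (simp add: underl_singleton(1)[OF assms])

lemma mem_underl_iff:
  assumes e: "e \<in> orbits (grp \<SS>) (ground (smat \<SS>)) (act \<SS>)" and X: "X \<in> central (smat \<SS>)"
  shows "e \<in> underl \<SS> X \<longleftrightarrow> X \<inter> e \<noteq> {}"
  using mem_orbit_iff[OF e] central_subset_ground[OF X] unfolding underl_def by blast

text \<open>Removing from a central set of full rank its only possible point in \<open>e\<close> costs at most the rank
  of that point.\<close>

lemma full_rank_le_deletion:
  assumes e: "e \<in> orbits (grp \<SS>) (ground (smat \<SS>)) (act \<SS>)"
  shows "full_rank (smat \<SS>) \<le> full_rank (deletion (smat \<SS>) e) + rk (orbit_triple \<SS>) {e}"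
proof -
  interpret D: finitary_semimatroid "deletion (smat \<SS>) e"
    by (rule finitary_semimatroid_deletion)
  obtain Z where Z: "Z \<in> central (smat \<SS>)" "rk (smat \<SS>) Z = full_rank (smat \<SS>)"
    using full_rank_attained by blast
  show ?thesis
  proof (cases "Z \<inter> e = {}")
    case True
    then show ?thesis
      using D.rk_le_full_rank[of Z] Z by simp
  next
    case False
    then obtain t where t: "t \<in> Z" "t \<in> e" by blast
    have "Z - {t} \<in> central (deletion (smat \<SS>) e)"
      using central_diff_orbit[OF e Z(1) t] central_down[OF Z(1)] by simp
    then have "rk (smat \<SS>) (Z - {t}) \<le> full_rank (deletion (smat \<SS>) e)"
      using D.rk_le_full_rank[of "Z - {t}"] by simp
    moreover have "(Z - {t}) \<union> {t} = Z"
      using t by auto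
    then have "rk (smat \<SS>) Z \<le> rk (smat \<SS>) (Z - {t}) + rk (smat \<SS>) {t}"
      using rk_Un_le[of "Z - {t}" "{t}"] Z by simp
    ultimately show ?thesis
      using Z rk_orbit_triple_singleton[OF e t(2)] by simp
  qed
qed

text \<open>Let \<open>X\<close> be a central set that misses \<open>e\<close>. Extend it to full rank inside the deletion, and the
  result to a set \<open>Z\<close> of full rank. Since the rank drops when \<open>e\<close> is deleted, \<open>Z\<close> contains a point
  \<open>t\<close> of \<open>e\<close>, and adding \<open>t\<close> to \<open>Z - {t}\<close> raises the rank. By submodularity, adding \<open>t\<close> to the
  smaller set \<open>X\<close> raises the rank as well, necessarily by one.\<close>

lemma isthmus_if_full_rank_deletion_less:
  assumes e: "e \<in> orbits (grp \<SS>) (ground (smat \<SS>)) (act \<SS>)"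
    and less: "full_rank (deletion (smat \<SS>) e) < full_rank (smat \<SS>)"
  shows "is_isthmus (orbit_triple \<SS>) e"
proof -
  interpret D: finitary_semimatroid "deletion (smat \<SS>) e"
    by (rule finitary_semimatroid_deletion)
  have "A \<union> {e} \<in> central (orbit_triple \<SS>) \<and>
      rk (orbit_triple \<SS>) (A \<union> {e}) = rk (orbit_triple \<SS>) A + 1"
    if A: "A \<in> central (orbit_triple \<SS>)" "e \<notin> A" for A
  proof -
    obtain X where X: "X \<in> central (smat \<SS>)" "A = underl \<SS> X"
      using A by (auto simp: orbit_triple_def)
    have Xe: "X \<inter> e = {}"
      using A X mem_underl_iff[OF e X(1)] by simp
    obtain Z where Z: "Z \<in> central (smat \<SS>)" "X \<subseteq> Z" "rk (smat \<SS>) Z = full_rank (smat \<SS>)"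
      using ex_full_rank_superset[OF X(1)] by blast
    have "Z \<inter> e \<noteq> {}"
      using D.rk_le_full_rank[of Z] Z less by auto
    then obtain t where t: "t \<in> Z" "t \<in> e" by blast
    let ?Y = "Z - {t}"
    have Y: "?Y \<in> central (smat \<SS>)" "?Y \<inter> e = {}"
      using central_diff_orbit[OF e Z(1) t] central_down[OF Z(1)] by auto
    then have rkY: "rk (smat \<SS>) ?Y < rk (smat \<SS>) Z"
      using D.rk_le_full_rank[of ?Y] Z(3) less by simp
    have tX: "t \<notin> X" "X \<subseteq> ?Y"
      using Xe t Z(2) by auto
    have Xt: "X \<union> {t} \<in> central (smat \<SS>)"
      using Z(1) by (rule central_down) (use tX t in auto)
    have "(X \<union> {t}) \<union> ?Y = Z" "(X \<union> {t}) \<inter> ?Y = X"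
      using tX t by auto
    then have "rk (smat \<SS>) Z + rk (smat \<SS>) X \<le> rk (smat \<SS>) (X \<union> {t}) + rk (smat \<SS>) ?Y"
      using R3[OF Xt Y(1)] Z(1) by simp
    then have "rk (smat \<SS>) X < rk (smat \<SS>) (X \<union> {t})"
      using rkY by simp
    moreover have "rk (smat \<SS>) {t} \<le> 1"
      using R1[of "{t}"] central_down[OF Xt, of "{t}"] by simp
    ultimately have "rk (smat \<SS>) (X \<union> {t}) = rk (smat \<SS>) X + 1"
      using rk_Un_le[OF Xt] by simp
    moreover have "underl \<SS> (X \<union> {t}) = A \<union> {e}"
      using underl_singleton(1)[OF e t(2)] X(2) by (auto simp: underl_def)
    ultimately show ?thesis
      using rk_orbit_triple_underl[OF Xt] rk_orbit_triple_underl[OF X(1)] X(2) Xt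
      by (auto simp: orbit_triple_def)
  qed
  then show ?thesis
    using e by (auto simp: is_isthmus_def orbit_triple_def)
qed

lemma rk_singleton_isthmus:
  assumes "is_isthmus (orbit_triple \<SS>) e"
  shows "rk (orbit_triple \<SS>) {e} = 1"
proof -
  have "{} \<in> central (orbit_triple \<SS>)"
    using empty_central by (force simp: orbit_triple_def underl_def)
  then have "rk (orbit_triple \<SS>) {e} = rk (orbit_triple \<SS>) {} + 1"
    using assms by (force simp: is_isthmus_def)
  moreover have "rk (orbit_triple \<SS>) {} = 0"
    using rk_orbit_triple_underl[OF empty_central] rk_empty by (simp add: underl_def)
  ultimately show ?thesis by simp
qed

lemma full_rank_deletion_isthmus:
  assumes e: "e \<in> orbits (grp \<SS>) (ground (smat \<SS>)) (act \<SS>)"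
    and isth: "is_isthmus (orbit_triple \<SS>) e"
  shows "full_rank (smat \<SS>) = full_rank (deletion (smat \<SS>) e) + 1"
proof (rule antisym)
  show "full_rank (smat \<SS>) \<le> full_rank (deletion (smat \<SS>) e) + 1"
    using full_rank_le_deletion[OF e] rk_singleton_isthmus[OF isth] by simp
  interpret D: finitary_semimatroid "deletion (smat \<SS>) e"
    by (rule finitary_semimatroid_deletion)
  obtain X where X: "X \<in> central (smat \<SS>)" "X \<inter> e = {}"
      "rk (smat \<SS>) X = full_rank (deletion (smat \<SS>) e)"
    using D.full_rank_attained by auto
  have "underl \<SS> X \<in> central (orbit_triple \<SS>)" "e \<notin> underl \<SS> X"
    using X mem_underl_iff[OF e X(1)] by (auto simp: orbit_triple_def)
  then have "underl \<SS> X \<union> {e} \<in> central (orbit_triple \<SS>)"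
      "rk (orbit_triple \<SS>) (underl \<SS> X \<union> {e}) = rk (orbit_triple \<SS>) (underl \<SS> X) + 1"
    using isth by (auto simp only: is_isthmus_def)
  then obtain W where "W \<in> central (smat \<SS>)"
      "rk (smat \<SS>) W = rk (smat \<SS>) X + 1"
    using rk_orbit_triple_underl X(1) by (fastforce simp: orbit_triple_def)
  then show "full_rank (deletion (smat \<SS>) e) + 1 \<le> full_rank (smat \<SS>)"
    using rk_le_full_rank[of W] X(3) by simp
qed

section \<open>Splitting the Tutte polynomial along an orbit\<close>

text \<open>Both exponents are \<open>0\<close> or \<open>1\<close>. The loop, isthmus and generic recursions are the three
  possible combinations, since \<open>e\<close> cannot be both a loop and an isthmus.\<close>

lemma tutte_poly_split:
  fixes x y :: "'r::comm_ring_1"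
  assumes cofin: "cofinite_action \<SS>"
    and e: "e \<in> orbits (grp \<SS>) (ground (smat \<SS>)) (act \<SS>)" and s: "s \<in> e"
  shows "tutte_poly \<SS> x y =
    (x - 1) ^ (full_rank (smat \<SS>) - full_rank (deletion (smat \<SS>) e))
      * tutte_poly (action_deletion \<SS> e) x y
    + (y - 1) ^ (1 - rk (orbit_triple \<SS>) {e}) * tutte_poly (action_contraction \<SS> s) x y"
proof -
  let ?S = "smat \<SS>"
  let ?D = "deletion ?S e" and ?K = "contraction ?S {s}"
  let ?w = "\<lambda>X. (x - 1) ^ (full_rank ?S - rk ?S X) * (y - 1) ^ (card X - rk ?S X)"
  have sg: "s \<in> ground ?S"
    using underl_singleton[OF e s] by simp
  then have sc: "{s} \<in> central ?S"
    by (rule central_singleton)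
  have rks: "rk (orbit_triple \<SS>) {e} = rk ?S {s}" "rk ?S {s} \<le> 1"
    using rk_orbit_triple_singleton[OF e s] R1[OF sc] by simp_all
  interpret D: translative_G_semimatroid "action_deletion \<SS> e"
    using e by (rule translative_G_semimatroid_deletion)
  interpret K: translative_G_semimatroid "action_contraction \<SS> s"
    using sg by (rule translative_G_semimatroid_contraction)
  have move: "\<exists>g \<in> carrier (grp \<SS>). act \<SS> g ` X \<inter> e \<noteq> {} \<longrightarrow> s \<in> act \<SS> g ` X"
    if X: "X \<in> central ?S" for X
  proof (cases "X \<inter> e = {}")
    case True
    moreover have "\<one>\<^bsub>grp \<SS>\<^esub> \<in> carrier (grp \<SS>)"
      using group_grp group.is_monoid monoid.one_closed by blast
    ultimately show ?thesis
      using act_image_meets_orbit_iff[OF e _ X] by blast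
  next
    case False
    then obtain t where t: "t \<in> X" "t \<in> e" by blast
    then have "s \<in> orbit (grp \<SS>) (act \<SS>) t"
      using mem_orbit_iff[OF e, of t] underl_singleton(2)[OF e t(2)] s by simp
    then show ?thesis
      using t by (auto simp: orbit_def)
  qed
  have "\<exists>R. finite R \<and> transversal \<SS> R \<and> (\<forall>X \<in> R. X \<inter> e \<noteq> {} \<longrightarrow> s \<in> X)"
    by (rule ex_transversal[OF cofin]) (rule move)
  then obtain R where R: "finite R" "transversal \<SS> R"
      and Rs: "\<And>X. X \<in> R \<Longrightarrow> X \<inter> e \<noteq> {} \<Longrightarrow> s \<in> X"
    by blast
  have R_central: "X \<in> R \<Longrightarrow> X \<in> central ?S" for X
    using R by (auto simp: transversal_def)
  let ?R0 = "{X \<in> R. X \<inter> e = {}}" and ?R1 = "{X \<in> R. s \<in> X}"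
  have split: "R = ?R0 \<union> ?R1" "?R0 \<inter> ?R1 = {}"
    using Rs s by auto
  have "sum ?w ?R0 = (\<Sum>X \<in> ?R0. (x - 1) ^ (full_rank ?S - full_rank ?D)
      * ((x - 1) ^ (full_rank ?D - rk ?S X) * (y - 1) ^ (card X - rk ?S X)))"
  proof (intro sum.cong refl)
    fix X assume X: "X \<in> ?R0"
    then have "rk ?S X \<le> full_rank ?D"
      using D.rk_le_full_rank[of X] R_central by simp
    then have "full_rank ?S - rk ?S X = (full_rank ?S - full_rank ?D) + (full_rank ?D - rk ?S X)"
      using full_rank_deletion_le[of e] by simp
    then show "?w X = (x - 1) ^ (full_rank ?S - full_rank ?D)
      * ((x - 1) ^ (full_rank ?D - rk ?S X) * (y - 1) ^ (card X - rk ?S X))"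
      by (simp add: power_add mult.assoc)
  qed
  also have "\<dots> = (x - 1) ^ (full_rank ?S - full_rank ?D) * tutte_poly (action_deletion \<SS> e) x y"
    using D.tutte_poly_transversal[OF _ transversal_deletion[OF e R(2)], of x y] R(1)
    by (simp add: sum_distrib_left)
  finally have sum0: "sum ?w ?R0 =
    (x - 1) ^ (full_rank ?S - full_rank ?D) * tutte_poly (action_deletion \<SS> e) x y" .
  let ?v = "\<lambda>Y. (x - 1) ^ (full_rank ?K - rk ?K Y) * (y - 1) ^ (card Y - rk ?K Y)"
  have "sum ?w ?R1 = (\<Sum>X \<in> ?R1. (y - 1) ^ (1 - rk ?S {s}) * ?v (X - {s}))"
  proof (intro sum.cong refl)
    fix X assume "X \<in> ?R1"
    then have X: "X \<in> central ?S" "s \<in> X"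
      using R_central by simp_all
    have rkK: "rk ?K (X - {s}) = rk ?S X - rk ?S {s}"
      using X by (simp add: insert_absorb)
    have ge: "rk ?S {s} \<le> rk ?S X"
      using X by (intro R2[OF sc]) auto
    have "X - {s} \<in> central ?K"
      using X central_down[of X "X - {s}"] by (simp add: insert_absorb)
    then have "rk ?K (X - {s}) \<le> card (X - {s})"
      using K.R1[of "X - {s}"] by (simp del: contraction_sel)
    moreover have "card X = card (X - {s}) + 1"
      using card_Suc_Diff1[OF central_finite[OF X(1)] X(2)] by simp
    \<comment> \<open>no truncation: all three differences of naturals are non-negative\<close>
    ultimately have "card X - rk ?S X = (1 - rk ?S {s}) + (card (X - {s}) - rk ?K (X - {s}))"
      using rkK ge rks(2) by linarith
    moreover have "full_rank ?S - rk ?S X = full_rank ?K - rk ?K (X - {s})"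
      using full_rank_contraction[OF sc] rkK ge by simp
    ultimately show "?w X = (y - 1) ^ (1 - rk ?S {s}) * ?v (X - {s})"
      by (simp add: power_add mult_ac del: contraction_sel)
  qed
  also have "\<dots> = (y - 1) ^ (1 - rk ?S {s}) * (\<Sum>X \<in> ?R1. ?v (X - {s}))"
    by (simp only: sum_distrib_left)
  also have "(\<Sum>X \<in> ?R1. ?v (X - {s})) = sum ?v ((\<lambda>X. X - {s}) ` ?R1)"
    by (subst sum.reindex) (auto simp: inj_on_def)
  also have "\<dots> = tutte_poly (action_contraction \<SS> s) x y"
    using K.tutte_poly_transversal[OF _ transversal_contraction[OF e s R(2) Rs], of x y] R(1)
    by (simp del: contraction_sel)
  finally have sum1: "sum ?w ?R1 = (y - 1) ^ (1 - rk ?S {s}) * tutte_poly (action_contraction \<SS> s) x y" .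
  have "tutte_poly \<SS> x y = sum ?w R"
    by (rule tutte_poly_transversal[OF R])
  also have "\<dots> = sum ?w (?R0 \<union> ?R1)"
    by (rule arg_cong[OF split(1)])
  also have "\<dots> = sum ?w ?R0 + sum ?w ?R1"
    using R(1) by (intro sum.union_disjoint split(2)) simp_all
  finally show ?thesis
    unfolding sum0 sum1 rks(1) .
qed

end

theorem theorem7:
  fixes \<SS> :: "('g, 'a) semimatroid_action"
    and e :: "'a set" and x\<^sub>e :: 'a
    and x y :: "'r::comm_ring_1"
  assumes "G_semimatroid \<SS>"
    and "cofinite_action \<SS>"
    and "translative \<SS>"
    and "e \<in> ground (orbit_triple \<SS>)"
    and "x\<^sub>e \<in> e"
  shows
    "(\<not> is_loop (orbit_triple \<SS>) e \<and> \<not> is_isthmus (orbit_triple \<SS>) e \<longrightarrow>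
        tutte_poly \<SS> x y =
          tutte_poly (action_contraction \<SS> x\<^sub>e) x y + tutte_poly (action_deletion \<SS> e) x y) \<and>
     (is_isthmus (orbit_triple \<SS>) e \<longrightarrow>
        tutte_poly \<SS> x y =
          (x - 1) * tutte_poly (action_deletion \<SS> e) x y
            + tutte_poly (action_contraction \<SS> x\<^sub>e) x y) \<and>
     (is_loop (orbit_triple \<SS>) e \<longrightarrow>
        tutte_poly \<SS> x y =
          tutte_poly (action_deletion \<SS> e) x y
            + (y - 1) * tutte_poly (action_contraction \<SS> x\<^sub>e) x y)"
proof -
  interpret translative_G_semimatroid \<SS>
    using assms(1,3) by (intro translative_G_semimatroid.intro translative_G_semimatroid_axioms.intro)
  let ?S = "smat \<SS>" and ?r = "rk (orbit_triple \<SS>) {e}"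
  let ?d = "full_rank ?S - full_rank (deletion ?S e)"
  have e: "e \<in> orbits (grp \<SS>) (ground ?S) (act \<SS>)"
    using assms(4) by (simp add: orbit_triple_def)
  have "?r \<le> 1"
    using rk_orbit_triple_singleton[OF e assms(5)] R1[OF central_singleton]
      underl_singleton(2)[OF e assms(5)] by fastforce
  have loop: "is_loop (orbit_triple \<SS>) e \<longleftrightarrow> ?r = 0"
    using assms(4) by (simp add: is_loop_def)
  note split = tutte_poly_split[OF assms(2) e assms(5), of x y]
  show ?thesis
  proof (intro conjI impI)
    assume "\<not> is_loop (orbit_triple \<SS>) e \<and> \<not> is_isthmus (orbit_triple \<SS>) e"
    then have "?d = 0" "?r = 1"
      using isthmus_if_full_rank_deletion_less[OF e] loop \<open>?r \<le> 1\<close> by force+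
    then show "tutte_poly \<SS> x y =
        tutte_poly (action_contraction \<SS> x\<^sub>e) x y + tutte_poly (action_deletion \<SS> e) x y"
      unfolding split by (simp only: power_0 diff_self_eq_0 mult_1_left add.commute)
  next
    assume isthmus: "is_isthmus (orbit_triple \<SS>) e"
    have "?d = 1" "?r = 1"
      using full_rank_deletion_isthmus[OF e isthmus] rk_singleton_isthmus[OF isthmus] by simp_all
    then show "tutte_poly \<SS> x y = (x - 1) * tutte_poly (action_deletion \<SS> e) x y
        + tutte_poly (action_contraction \<SS> x\<^sub>e) x y"
      unfolding split by (simp only: power_0 power_one_right diff_self_eq_0 mult_1_left)
  next
    assume "is_loop (orbit_triple \<SS>) e"
    then have "?r = 0"
      using loop by blast
    moreover from this have "?d = 0"
      using full_rank_le_deletion[OF e] by simp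
    ultimately show "tutte_poly \<SS> x y = tutte_poly (action_deletion \<SS> e) x y
        + (y - 1) * tutte_poly (action_contraction \<SS> x\<^sub>e) x y"
      unfolding split by (simp only: power_0 power_one_right diff_zero mult_1_left)
  qed
qed

end
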